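(* Let $p\ge 1$ be an integer and let $\boldsymbol{\beta}=(\beta_0,\ldots,\beta_{p-1})$ be a $p$-tuple of real numbers greater than $1$. For all $x\in[0,x_{\boldsymbol{\beta}})$, we have $T_{\beta_{p-1}\cdots\beta_0,\Delta_{\boldsymbol{\beta}}}(x)\le\pi_2\circ T_{\boldsymbol{\beta}}^p\circ\delta_0(x)$, and for all $x\in(0,x_{\boldsymbol{\beta}}]$, we have $L_{\beta_{p-1}\cdots\beta_0,\Delta_{\boldsymbol{\beta}}}(x)\ge\pi_2\circ L_{\boldsymbol{\beta}}^p\circ\delta_0(x)$.
   Context: Conventions: for $n\in\mathbb{Z}$, $\beta_n=\beta_{n\bmod p}$ and $\boldsymbol{\beta}^{(n)}=(\beta_n,\ldots,\beta_{n+p-1})$; empty products equal $1$. $x_{\boldsymbol{\beta}}=\sum_{n=0}^\infty\frac{\lceil\beta_n\rceil-1}{\prod_{k=0}^n\beta_k}$ (finite and $\ge1$), and $x_{\boldsymbol{\beta}^{(n)}}$ is the same quantity for $\boldsymbol{\beta}^{(n)}$. $\delta_0(x)=(0,x)$ and $\pi_2(n,x)=x$. Extended greedy $\boldsymbol{\beta}$-transformation on $\bigcup_{i=0}^{p-1}(\{i\}\times[0,x_{\boldsymbol{\beta}^{(i)}}))$: $T_{\boldsymbol{\beta}}(i,x)=((i+1)\bmod p,\ \beta_ix-\lfloor\beta_ix\rfloor)$ if $x\in[0,1)$, and $T_{\boldsymbol{\beta}}(i,x)=((i+1)\bmod p,\ \beta_ix-(\lceil\beta_i\rceil-1))$ if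 $x\in[1,x_{\boldsymbol{\beta}^{(i)}})$. Lazy $\boldsymbol{\beta}$-transformation on $\bigcup_{i=0}^{p-1}(\{i\}\times(0,x_{\boldsymbol{\beta}^{(i)}}])$: $L_{\boldsymbol{\beta}}(i,x)=((i+1)\bmod p,\ \beta_ix)$ if $x\in(0,x_{\boldsymbol{\beta}^{(i)}}-1]$, and $L_{\boldsymbol{\beta}}(i,x)=((i+1)\bmod p,\ \beta_ix-\lceil\beta_ix-x_{\boldsymbol{\beta}^{(i+1)}}\rceil)$ if $x\in(x_{\boldsymbol{\beta}^{(i)}}-1,x_{\boldsymbol{\beta}^{(i)}}]$. $\Delta_{\boldsymbol{\beta}}=\{\sum_{i=0}^{p-1}\beta_{p-1}\cdots\beta_{i+1}c_i\colon c_i\in\{0,\ldots,\lceil\beta_i\rceil-1\}\text{ for all }i\}$. For a real $\beta>1$ and a finite set $\Delta=\{d_0,\ldots,d_m\}$ with $0=d_0<d_1<\cdots<d_m$ and $\max_{0\le k\le m-1}(d_{k+1}-d_k)\le\frac{d_m}{\beta-1}$ (an allowable digit set for $\beta$): the greedy $(\beta,\Delta)$-transformation $T_{\beta,\Delta}$ on $[0,\frac{d_m}{\beta-1})$ is $T_{\beta,\Delta}(x)=\beta x-d_k$ if $x\in[\frac{d_k}{\beta},\frac{d_{k+1}}{\beta})$ with $0\le k\le m-1$, and $\beta x-d_m$ if $x\in[\frac{d_m}{\beta},\frac{d_m}{\beta-1})$; the lazy $(\beta,\Delta)$-transformation $L_{\beta,\Delta}$ on $(0,\frac{d_m}{\beta-1}]$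 is $L_{\beta,\Delta}(x)=\beta x$ if $x\in(0,\frac{d_m}{\beta-1}-\frac{d_m}{\beta}]$, and $\beta x-d_k$ if $x\in(\frac{d_m}{\beta-1}-\frac{d_m-d_{k-1}}{\beta},\frac{d_m}{\beta-1}-\frac{d_m-d_k}{\beta}]$ with $1\le k\le m$. The set $\Delta_{\boldsymbol{\beta}}$ is an allowable digit set for $\beta_{p-1}\cdots\beta_0$, and $x_{\boldsymbol{\beta}}=\frac{\max\Delta_{\boldsymbol{\beta}}}{\beta_{p-1}\cdots\beta_0-1}$. *)

theory Defs
  imports Complex_Main
begin

text \<open>A tuple \<open>(\<beta>\<^sub>0, \<dots>, \<beta>\<^sub>p\<^sub>-\<^sub>1)\<close> is a list of length \<open>p\<close>; the shifted tuple
  \<open>(\<beta>\<^sub>n, \<dots>, \<beta>\<^sub>n\<^sub>+\<^sub>p\<^sub>-\<^sub>1)\<close> with indices modulo \<open>p\<close> is \<open>rotate n \<beta>\<close>.\<close>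

definition base :: "real list \<Rightarrow> nat \<Rightarrow> real" where
  "base \<beta> n = \<beta> ! (n mod length \<beta>)"

definition x_sup :: "real list \<Rightarrow> real" where
  "x_sup \<beta> = (\<Sum>n. (of_int \<lceil>base \<beta> n\<rceil> - 1) / (\<Prod>k\<le>n. base \<beta> k))"

definition delta0 :: "real \<Rightarrow> nat \<times> real" where
  "delta0 x = (0, x)"

text \<open>The transformations below take the value \<open>undefined\<close> outside their domains.\<close>

definition greedy_map :: "real list \<Rightarrow> nat \<times> real \<Rightarrow> nat \<times> real" where
  "greedy_map \<beta> = (\<lambda>(i, x).
     if i < length \<beta> \<and> x \<in> {0..<1} then
       ((i + 1) mod length \<beta>, base \<beta> i * x - of_int \<lfloor>base \<beta> i * x\<rfloor>)
     else if i < length \<beta> \<and> x \<in> {1..<x_sup (rotate i \<beta>)} then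
       ((i + 1) mod length \<beta>, base \<beta> i * x - (of_int \<lceil>base \<beta> i\<rceil> - 1))
     else undefined)"

definition lazy_map :: "real list \<Rightarrow> nat \<times> real \<Rightarrow> nat \<times> real" where
  "lazy_map \<beta> = (\<lambda>(i, x).
     if i < length \<beta> \<and> x \<in> {0<..x_sup (rotate i \<beta>) - 1} then
       ((i + 1) mod length \<beta>, base \<beta> i * x)
     else if i < length \<beta> \<and> x \<in> {x_sup (rotate i \<beta>) - 1<..x_sup (rotate i \<beta>)} then
       ((i + 1) mod length \<beta>,
        base \<beta> i * x - of_int \<lceil>base \<beta> i * x - x_sup (rotate (i + 1) \<beta>)\<rceil>)
     else undefined)"

definition digit_set :: "real list \<Rightarrow> real set" where
  "digit_set \<beta> =
     {(\<Sum>i<length \<beta>. (\<Prod>j\<in>{i<..<length \<beta>}. base \<beta> j) * of_int (c i)) | c :: nat \<Rightarrow> int.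
        \<forall>i<length \<beta>. c i \<in> {0..\<lceil>base \<beta> i\<rceil> - 1}}"

text \<open>For a finite set \<open>D = {d\<^sub>0 < \<dots> < d\<^sub>m}\<close>, \<open>digit D k\<close> is \<open>d\<^sub>k\<close> and \<open>top_index D\<close> is \<open>m\<close>.\<close>

definition digit :: "real set \<Rightarrow> nat \<Rightarrow> real" where
  "digit D k = sorted_list_of_set D ! k"

definition top_index :: "real set \<Rightarrow> nat" where
  "top_index D = card D - 1"

text \<open>The two transformations with a general digit set are intended for \<open>b > 1\<close> and a finite
  \<open>D\<close> with \<open>d\<^sub>0 = 0 < d\<^sub>m\<close> and all gaps \<open>d\<^sub>k\<^sub>+\<^sub>1 - d\<^sub>k\<close> at most \<open>d\<^sub>m / (b - 1)\<close> (an allowable digit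
  set for \<open>b\<close>). The intervals indexed by \<open>k\<close> are pairwise disjoint, so \<open>THE\<close> picks the unique
  index whose interval contains \<open>x\<close>.\<close>

definition greedy_interval :: "real \<Rightarrow> real set \<Rightarrow> nat \<Rightarrow> real set" where
  "greedy_interval b D k = {digit D k / b ..< digit D (k + 1) / b}"

definition greedy_digit_map :: "real \<Rightarrow> real set \<Rightarrow> real \<Rightarrow> real" where
  "greedy_digit_map b D x =
     (let m = top_index D; d = digit D in
      if \<exists>k<m. x \<in> greedy_interval b D k then
        b * x - d (THE k. k < m \<and> x \<in> greedy_interval b D k)
      else if x \<in> {d m / b ..< d m / (b - 1)} then b * x - d m
      else undefined)"

definition lazy_interval :: "real \<Rightarrow> real set \<Rightarrow> nat \<Rightarrow> real set" where
  "lazy_interval b D k =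
     (let m = top_index D; d = digit D in
      {d m / (b - 1) - (d m - d (k - 1)) / b <.. d m / (b - 1) - (d m - d k) / b})"

definition lazy_digit_map :: "real \<Rightarrow> real set \<Rightarrow> real \<Rightarrow> real" where
  "lazy_digit_map b D x =
     (let m = top_index D; d = digit D in
      if x \<in> {0 <.. d m / (b - 1) - d m / b} then b * x
      else if \<exists>k\<in>{1..m}. x \<in> lazy_interval b D k then
        b * x - d (THE k. k \<in> {1..m} \<and> x \<in> lazy_interval b D k)
      else undefined)"

end

theory Submission
  imports Defs "HOL-Library.FuncSet"
begin

text \<open>Write \<open>B\<close> for the product of the bases. Both transformations are extremal among the maps
  \<open>x \<mapsto> B x - s\<close> with \<open>s\<close> a digit: the greedy one subtracts the largest digit \<open>s \<le> B x\<close>, so that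
  \<open>B x - s \<ge> 0\<close>, and the lazy one the smallest digit with \<open>B x - s \<le> x_sup \<beta>\<close>. Following an orbit of
  the \<open>\<beta>\<close>-transformation for \<open>p\<close> steps also subtracts a digit \<open>s\<close> from \<open>B x\<close>, and the result lies
  between \<open>0\<close> and \<open>x_sup \<beta>\<close> because every step stays in the domain. The domains and the largest
  digit are controlled by \<open>\<beta>\<^sub>i x\<^sub>i = \<lceil>\<beta>\<^sub>i\<rceil> - 1 + x\<^sub>i\<^sub>+\<^sub>1\<close>, where \<open>x\<^sub>i\<close> is the supremum for the
  \<open>i\<close>-th shift, and by \<open>x\<^sub>i \<ge> 1\<close>.\<close>

section \<open>General digit sets\<close>

lemma digit_mem:
  assumes "finite D" "k < card D"
  shows "digit D k \<in> D"
  using assms unfolding digit_def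
  by (metis length_sorted_list_of_set nth_mem set_sorted_list_of_set)

lemma mem_digit:
  assumes "finite D" "s \<in> D"
  obtains k where "k < card D" "s = digit D k"
  using assms unfolding digit_def
  by (metis in_set_conv_nth length_sorted_list_of_set set_sorted_list_of_set)

lemma digit_mono:
  assumes "j \<le> k" "k < card D"
  shows "digit D j \<le> digit D k"
  using assms unfolding digit_def by (intro sorted_nth_mono) auto

lemma digit_zero:
  assumes "finite D" "D \<noteq> {}"
  shows "digit D 0 = Min D"
  using assms unfolding digit_def
  by (simp add: sorted_list_of_set_nonempty)

lemma digit_top:
  assumes "finite D" "D \<noteq> {}"
  shows "digit D (top_index D) = Max D"
proof (rule sym, rule Max_eqI)
  have pos: "card D > 0" using assms by (simp add: card_gt_0_iff)
  show "digit D (top_index D) \<in> D"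
    using assms(1) pos by (intro digit_mem) (auto simp: top_index_def)
  show "s \<le> digit D (top_index D)" if "s \<in> D" for s
  proof -
    obtain k where "k < card D" "s = digit D k" using mem_digit assms(1) \<open>s \<in> D\<close> by blast
    then show ?thesis using pos by (auto simp: top_index_def intro!: digit_mono)
  qed
qed (use assms in auto)

text \<open>Clearing the denominator turns interval \<open>k\<close> into
  \<open>digit D k \<le> b * x < digit D (k + 1)\<close>, so the digit selected is the last one not
  above \<open>b * x\<close>, and \<open>s\<close> cannot exceed it.\<close>

lemma greedy_digit_map_le:
  assumes fin: "finite D" and b: "b > 1" and min: "Min D = 0" and max: "Max D = (b - 1) * X"
    and x: "0 \<le> x" "x < X" and s: "s \<in> D" "s \<le> b * x"
  shows "greedy_digit_map b D x \<le> b * x - s"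
proof -
  define m where "m = top_index D"
  have ne: "D \<noteq> {}" using s by auto
  have card: "card D = Suc m" using fin ne by (simp add: m_def top_index_def card_gt_0_iff)
  have d0: "digit D 0 = 0" using digit_zero fin ne min by simp
  have dm: "digit D m = (b - 1) * X" using digit_top fin ne max by (simp add: m_def)
  obtain j where j: "j \<le> m" "s = digit D j"
    using mem_digit[OF fin s(1)] card by (metis less_Suc_eq_le)
  have interval: "x \<in> greedy_interval b D k \<longleftrightarrow> digit D k \<le> b * x \<and> b * x < digit D (k + 1)" for k
    using b by (simp add: greedy_interval_def field_simps)
  show ?thesis
  proof (cases "\<exists>k<m. x \<in> greedy_interval b D k")
    case True
    then obtain k where k: "k < m" "x \<in> greedy_interval b D k" by blast
    \<comment> \<open>Serves twice: for uniqueness of the index under \<open>THE\<close>, and to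
      bound the index of \<open>s\<close>.\<close>
    have below: "i \<le> k'" if "k' < m" "x \<in> greedy_interval b D k'" "i \<le> m" "digit D i \<le> b * x" for i k'
    proof (rule ccontr)
      assume "\<not> i \<le> k'"
      then have "digit D (k' + 1) \<le> digit D i" using that card by (intro digit_mono) auto
      then show False using that interval by auto
    qed
    have "(THE k. k < m \<and> x \<in> greedy_interval b D k) = k"
    proof (rule the_equality)
      show "k' = k" if "k' < m \<and> x \<in> greedy_interval b D k'" for k'
        using that k below[of k' k] below[of k k'] interval by fastforce
    qed (use k in simp)
    then have "greedy_digit_map b D x = b * x - digit D k"
      using True by (simp add: greedy_digit_map_def m_def)
    moreover have "s \<le> digit D k"
      using below[OF k j(1)] s(2) j card k(1) by (auto intro: digit_mono)
    ultimately show ?thesis by simp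
  next
    case False
    \<comment> \<open>With no interval available, \<open>b * x\<close> passes every digit in turn,
      starting from \<open>digit D 0 = 0\<close>, so the branch of the largest digit
      applies.\<close>
    have "digit D k \<le> b * x" if "k \<le> m" for k
      using that
    proof (induction k)
      case 0
      then show ?case using d0 b x by simp
    next
      case (Suc k)
      then show ?case using False interval[of k] by force
    qed
    then have "digit D m \<le> b * x" by simp
    then have "x \<in> {digit D m / b ..< digit D m / (b - 1)}"
      using b x by (auto simp: dm pos_divide_le_eq mult.commute)
    then have "greedy_digit_map b D x = b * x - digit D m"
      using False unfolding greedy_digit_map_def Let_def m_def by auto
    moreover have "s \<le> digit D m"
      using j card by (auto intro: digit_mono)
    ultimately show ?thesis by simp
  qed
qed

text \<open>The digit selected is the least one not below \<open>b * x - X\<close>, and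
  \<open>s\<close> is some digit with that property.\<close>

lemma lazy_digit_map_ge:
  assumes fin: "finite D" and b: "b > 1" and min: "Min D = 0" and max: "Max D = (b - 1) * X"
    and x: "0 < x" "x \<le> X" and s: "s \<in> D" "b * x - s \<le> X"
  shows "b * x - s \<le> lazy_digit_map b D x"
proof -
  define m where "m = top_index D"
  have ne: "D \<noteq> {}" using s by auto
  have card: "card D = Suc m" using fin ne by (simp add: m_def top_index_def card_gt_0_iff)
  have d0: "digit D 0 = 0" using digit_zero fin ne min by simp
  have dm: "digit D m = (b - 1) * X" using digit_top fin ne max by (simp add: m_def)
  obtain j where j: "j \<le> m" "s = digit D j"
    using mem_digit[OF fin s(1)] card by (metis less_Suc_eq_le)
  \<comment> \<open>Since \<open>digit D m = (b - 1) * X\<close>, the endpoint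
    \<open>X - (digit D m - d) / b\<close> is \<open>(X + d) / b\<close>.\<close>
  have bound: "y \<le> X - (digit D m - d) / b \<longleftrightarrow> b * y - X \<le> d" for y d
    using b by (simp add: dm field_simps)
  have dmX: "digit D m / (b - 1) = X"
    using b by (simp add: dm)
  have interval: "x \<in> lazy_interval b D k \<longleftrightarrow> digit D (k - 1) < b * x - X \<and> b * x - X \<le> digit D k" for k
    using bound[of x "digit D (k - 1)"] bound[of x "digit D k"]
    by (auto simp: lazy_interval_def Let_def dmX simp flip: m_def)
  have first: "x \<in> {0<..digit D m / (b - 1) - digit D m / b} \<longleftrightarrow> b * x - X \<le> 0"
    using bound[of x 0] x by (simp add: dmX)
  show ?thesis
  proof (cases "b * x - X \<le> 0")
    case True
    then have "lazy_digit_map b D x = b * x"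
      using first by (simp add: lazy_digit_map_def m_def)
    moreover have "s \<ge> 0"
      using min fin s by (metis Min_le)
    ultimately show ?thesis by simp
  next
    case False
    \<comment> \<open>Such an index exists because \<open>x \<le> X\<close> makes \<open>m\<close> a
      candidate; it is not 0 because the first branch is excluded here.\<close>
    define k where "k = (LEAST k. b * x - X \<le> digit D k)"
    have "b * x \<le> b * X" using x b by simp
    then have top: "b * x - X \<le> digit D m" by (simp add: dm algebra_simps)
    then have k1: "b * x - X \<le> digit D k" unfolding k_def by (rule LeastI)
    have k2: "k \<le> i" if "b * x - X \<le> digit D i" for i
      using that unfolding k_def by (rule Least_le)
    have "k \<noteq> 0" using k1 d0 False by (intro notI) simp
    then have "\<not> b * x - X \<le> digit D (k - 1)" using k2[of "k - 1"] by auto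
    then have k: "k \<in> {1..m}" "x \<in> lazy_interval b D k"
      using k1 k2[OF top] \<open>k \<noteq> 0\<close> interval by auto
    have above: "k' \<le> i" if "k' \<in> {1..m}" "x \<in> lazy_interval b D k'" "b * x - X \<le> digit D i" for i k'
    proof (rule ccontr)
      assume "\<not> k' \<le> i"
      then have "digit D i \<le> digit D (k' - 1)" using that card by (intro digit_mono) auto
      then show False using that interval by auto
    qed
    have "(THE k. k \<in> {1..m} \<and> x \<in> lazy_interval b D k) = k"
    proof (rule the_equality)
      show "k' = k" if "k' \<in> {1..m} \<and> x \<in> lazy_interval b D k'" for k'
        using that k above[of k' k] k2[of k'] interval k1 by (metis order_antisym)
    qed (use k in simp)
    then have "lazy_digit_map b D x = b * x - digit D k"
      using k first False unfolding lazy_digit_map_def Let_def m_def by auto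
    moreover have "digit D k \<le> s"
      using k2[of j] s(2) j card by (auto intro!: digit_mono)
    ultimately show ?thesis by simp
  qed
qed

section \<open>Tuples of bases\<close>

lemma base_rotate: "\<beta> \<noteq> [] \<Longrightarrow> base (rotate i \<beta>) n = base \<beta> (i + n)"
  by (simp add: base_def nth_rotate mod_add_right_eq)

lemma rotate_mod_length: "rotate (n mod length xs) xs = rotate n xs"
  by (metis rotate_conv_mod)

text \<open>Horner's scheme in mixed radix with leading digit \<open>c 0\<close>. The number
  \<open>n\<close> of digits is kept apart from \<open>length \<beta>\<close> to allow induction on
  it.\<close>

definition horner :: "real list \<Rightarrow> (nat \<Rightarrow> int) \<Rightarrow> nat \<Rightarrow> real" where
  "horner \<beta> c n = (\<Sum>i<n. (\<Prod>j\<in>{i<..<n}. base \<beta> j) * of_int (c i))"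

lemma horner_Suc: "horner \<beta> c (Suc n) = base \<beta> n * horner \<beta> c n + of_int (c n)"
proof -
  have "{i<..<Suc n} = insert n {i<..<n}" if "i < n" for i
    using that by auto
  then have "(\<Sum>i<n. (\<Prod>j\<in>{i<..<Suc n}. base \<beta> j) * of_int (c i))
      = (\<Sum>i<n. base \<beta> n * ((\<Prod>j\<in>{i<..<n}. base \<beta> j) * of_int (c i)))"
    by (intro sum.cong) auto
  moreover have "{n<..<Suc n} = {}" by auto
  ultimately show ?thesis
    by (simp add: horner_def sum_distrib_left)
qed

text \<open>Each step multiplies what was subtracted so far by the next base and adds a digit, as in
  \<open>horner_Suc\<close>. Used for orbits and also for the suprema of the shifts.\<close>

lemma horner_iterate:
  assumes "\<And>i. i < n \<Longrightarrow> y (Suc i) = base \<beta> i * y i - of_int (c i)"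
  shows "y n = (\<Prod>i<n. base \<beta> i) * y 0 - horner \<beta> c n"
  using assms
proof (induction n)
  case 0
  then show ?case by (simp add: horner_def)
next
  case (Suc n)
  then have IH: "y n = (\<Prod>i<n. base \<beta> i) * y 0 - horner \<beta> c n" by simp
  have "y (Suc n) = base \<beta> n * y n - of_int (c n)" using Suc.prems by simp
  then show ?case unfolding IH by (simp add: horner_Suc algebra_simps)
qed

lemma digit_set_horner:
  "digit_set \<beta> = (\<lambda>c. horner \<beta> c (length \<beta>)) `
     {c. \<forall>i<length \<beta>. c i \<in> {0..\<lceil>base \<beta> i\<rceil> - 1}}"
  by (auto simp: digit_set_def horner_def)

text \<open>\<open>horner\<close> reads \<open>c\<close> only below \<open>length \<beta>\<close>;
  restricting \<open>c\<close> to that range leaves a finite function space.\<close>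

lemma finite_digit_set: "finite (digit_set \<beta>)"
proof (rule finite_subset)
  let ?P = "PiE {..<length \<beta>} (\<lambda>i. {0..\<lceil>base \<beta> i\<rceil> - 1})"
  show "digit_set \<beta> \<subseteq> (\<lambda>c. horner \<beta> c (length \<beta>)) ` ?P"
  proof
    fix s assume "s \<in> digit_set \<beta>"
    then obtain c where c: "\<forall>i<length \<beta>. c i \<in> {0..\<lceil>base \<beta> i\<rceil> - 1}" "s = horner \<beta> c (length \<beta>)"
      by (auto simp: digit_set_horner)
    then have "s = horner \<beta> (restrict c {..<length \<beta>}) (length \<beta>)"
      by (simp add: horner_def)
    moreover have "restrict c {..<length \<beta>} \<in> ?P" using c by auto
    ultimately show "s \<in> (\<lambda>c. horner \<beta> c (length \<beta>)) ` ?P" by blast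
  qed
  show "finite ((\<lambda>c. horner \<beta> c (length \<beta>)) ` ?P)"
    by (intro finite_imageI finite_PiE) auto
qed

section \<open>Convergence of \<open>x_sup\<close> and its recursion under shifts\<close>

context
  fixes \<beta> :: "real list"
  assumes nonempty: "\<beta> \<noteq> []" and gt1: "\<forall>i<length \<beta>. \<beta> ! i > 1"
begin

text \<open>A bound uniform in \<open>n\<close> supplies the ratio of the geometric majorant for
  \<open>x_sup\<close>.\<close>

lemma base_lower: obtains q where "q > 1" "\<And>n. base \<beta> n \<ge> q"
proof
  show "Min (set \<beta>) > 1"
    using nonempty gt1 by (auto simp: in_set_conv_nth)
  show "base \<beta> n \<ge> Min (set \<beta>)" for n
    using nonempty by (simp add: base_def)
qed

lemma base_gt_1: "base \<beta> n > 1"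
  using nonempty gt1 by (simp add: base_def)

lemma summable_x_sup:
  "summable (\<lambda>n. (of_int \<lceil>base \<beta> n\<rceil> - 1) / (\<Prod>k\<le>n. base \<beta> k))"
proof -
  obtain q where q: "q > 1" "\<And>n. base \<beta> n \<ge> q" using base_lower by blast
  define M where "M = Max (set \<beta>)"
  have M: "base \<beta> n \<le> M" for n
    using nonempty by (simp add: base_def M_def)
  show ?thesis
  proof (rule summable_comparison_test')
    show "summable (\<lambda>n. M * (1 / q) ^ Suc n)"
      using q by (intro summable_mult summable_Suc_iff[THEN iffD2] summable_geometric) auto
    fix n :: nat
    have "q ^ Suc n = (\<Prod>k\<le>n. q)" by simp
    also have "\<dots> \<le> (\<Prod>k\<le>n. base \<beta> k)"
      using q by (intro prod_mono) (auto simp: less_imp_le order_trans[of 0 1 q])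
    finally have "(of_int \<lceil>base \<beta> n\<rceil> - 1) / (\<Prod>k\<le>n. base \<beta> k) \<le> M / q ^ Suc n"
      using q(1) M[of n] base_gt_1[of n]
      by (intro frac_le zero_less_power) linarith+
    moreover have "0 \<le> (of_int \<lceil>base \<beta> n\<rceil> - 1) / (\<Prod>k\<le>n. base \<beta> k)"
      using base_gt_1[of n] base_gt_1
      by (intro divide_nonneg_nonneg prod_nonneg) (auto intro: less_imp_le less_trans[OF zero_less_one])
    ultimately show "norm ((of_int \<lceil>base \<beta> n\<rceil> - 1) / (\<Prod>k\<le>n. base \<beta> k)) \<le> M * (1 / q) ^ Suc n"
      by (simp add: power_divide)
  qed
qed

text \<open>Multiplication by \<open>base \<beta> 0\<close> cancels the first factor of every
  denominator: the first term becomes its numerator, the tail the series of the shifted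
  tuple.\<close>

lemma x_sup_rec0: "base \<beta> 0 * x_sup \<beta> = of_int (\<lceil>base \<beta> 0\<rceil> - 1) + x_sup (rotate 1 \<beta>)"
proof -
  define f where "f = (\<lambda>n. (of_int \<lceil>base \<beta> n\<rceil> - 1) / (\<Prod>k\<le>n. base \<beta> k))"
  have sum: "summable f" using summable_x_sup by (simp add: f_def)
  have b0: "base \<beta> 0 \<noteq> 0" using base_gt_1[of 0] by simp
  have shift: "(of_int \<lceil>base (rotate 1 \<beta>) n\<rceil> - 1) / (\<Prod>k\<le>n. base (rotate 1 \<beta>) k)
      = base \<beta> 0 * f (Suc n)" for n
    using b0 nonempty unfolding f_def prod.atMost_Suc_shift base_rotate[OF nonempty] by simp
  have "x_sup (rotate 1 \<beta>) = base \<beta> 0 * (\<Sum>n. f (Suc n))"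
    unfolding x_sup_def shift using sum by (intro suminf_mult) (simp add: summable_Suc_iff)
  also have "(\<Sum>n. f (Suc n)) = x_sup \<beta> - f 0"
    using suminf_split_head[OF sum] by (simp add: x_sup_def f_def)
  finally have "x_sup (rotate 1 \<beta>) = base \<beta> 0 * x_sup \<beta> - base \<beta> 0 * f 0"
    by (simp add: algebra_simps)
  then show ?thesis using b0 by (simp add: f_def)
qed

end

context
  fixes \<beta> :: "real list"
  assumes nonempty: "\<beta> \<noteq> []" and gt1: "\<forall>i<length \<beta>. \<beta> ! i > 1"
begin

text \<open>This is \<open>x_sup_rec0\<close> for the tuple \<open>rotate i \<beta>\<close>. A
  second context is opened because \<open>\<beta>\<close> is fixed inside the first.\<close>

lemma x_sup_rec:
  "x_sup (rotate (Suc i) \<beta>) = base \<beta> i * x_sup (rotate i \<beta>) - of_int (\<lceil>base \<beta> i\<rceil> - 1)"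
proof -
  have "\<forall>j<length (rotate i \<beta>). rotate i \<beta> ! j > 1"
    using gt1 nonempty by (simp add: nth_rotate)
  from x_sup_rec0[OF _ this] nonempty show ?thesis
    by (simp add: base_rotate rotate_rotate)
qed

text \<open>There are finitely many shifts. At the one with the smallest supremum, the recursion and
  \<open>X j \<le> X (Suc j)\<close> give
  \<open>(base \<beta> j - 1) * (X j - 1) \<ge> 0\<close>.\<close>

lemma x_sup_ge_1: "x_sup (rotate i \<beta>) \<ge> 1"
proof -
  define X where "X i = x_sup (rotate i \<beta>)" for i
  define S where "S = X ` {..<length \<beta>}"
  have X_S: "X i \<in> S" for i
    using nonempty unfolding S_def X_def
    by (intro image_eqI[where x = "i mod length \<beta>"]) (simp_all add: rotate_mod_length)
  have S: "finite S" "S \<noteq> {}" using X_S by (auto simp: S_def)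
  obtain j where j: "X j = Min S" using Min_in[OF S] by (auto simp: S_def)
  have b: "base \<beta> j > 1" using base_gt_1 nonempty gt1 by blast
  have "X j \<le> X (Suc j)" using S X_S by (simp add: j)
  also have "\<dots> \<le> base \<beta> j * X j - (base \<beta> j - 1)"
    unfolding X_def x_sup_rec using le_of_int_ceiling[of "base \<beta> j"] by simp
  finally have "0 \<le> (base \<beta> j - 1) * (X j - 1)" by (simp add: algebra_simps)
  then have "X j \<ge> 1" using b by (simp add: zero_le_mult_iff)
  then show ?thesis using S X_S[of i] j by (metis Min_le X_def order_trans)
qed

section \<open>Extreme elements of the digit set\<close>

lemma prod_base_gt_1: "(\<Prod>i<length \<beta>. base \<beta> i) > 1"
proof -
  have "base \<beta> i > 1" for i using base_gt_1 nonempty gt1 by blast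
  then show ?thesis using nonempty by (intro less_1_prod) auto
qed

lemma horner_mono:
  assumes "\<And>i. i < n \<Longrightarrow> c i \<le> c' i"
  shows "horner \<beta> c n \<le> horner \<beta> c' n"
  unfolding horner_def
proof (intro sum_mono mult_left_mono prod_nonneg)
  show "base \<beta> i \<ge> 0" for i using base_gt_1[OF nonempty gt1, of i] by simp
qed (use assms in auto)

lemma Min_digit_set: "Min (digit_set \<beta>) = 0"
proof (rule Min_eqI[OF finite_digit_set])
  have "base \<beta> i > 1" for i using base_gt_1 nonempty gt1 by blast
  then show "0 \<in> digit_set \<beta>"
    unfolding digit_set_horner
    by (intro image_eqI[where x = "\<lambda>_. 0"]) (auto simp: horner_def order_le_less)
  show "0 \<le> s" if s: "s \<in> digit_set \<beta>" for s
  proof -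
    obtain c where "\<forall>i<length \<beta>. c i \<ge> 0" "s = horner \<beta> c (length \<beta>)"
      using s by (auto simp: digit_set_horner)
    then show ?thesis using horner_mono[of "length \<beta>" "\<lambda>_. 0" c] by (simp add: horner_def)
  qed
qed

text \<open>By \<open>x_sup_rec\<close> the suprema of the shifts follow the recursion with all
  digits maximal and return to \<open>x_sup \<beta>\<close> after a full cycle;
  \<open>horner_iterate\<close> then evaluates the largest digit.\<close>

lemma Max_digit_set: "Max (digit_set \<beta>) = ((\<Prod>i<length \<beta>. base \<beta> i) - 1) * x_sup \<beta>"
proof (rule Max_eqI[OF finite_digit_set])
  define c where "c i = \<lceil>base \<beta> i\<rceil> - 1" for i
  have top: "((\<Prod>i<length \<beta>. base \<beta> i) - 1) * x_sup \<beta> = horner \<beta> c (length \<beta>)"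
    using horner_iterate[of "length \<beta>" "\<lambda>i. x_sup (rotate i \<beta>)" \<beta> c] x_sup_rec
    by (simp add: c_def algebra_simps)
  have "base \<beta> i > 1" for i using base_gt_1 nonempty gt1 by blast
  then have "c i \<ge> 0" for i by (simp add: c_def order_le_less)
  then show "((\<Prod>i<length \<beta>. base \<beta> i) - 1) * x_sup \<beta> \<in> digit_set \<beta>"
    unfolding digit_set_horner top by (intro image_eqI[where x = c]) (auto simp: c_def)
  show "s \<le> ((\<Prod>i<length \<beta>. base \<beta> i) - 1) * x_sup \<beta>" if "s \<in> digit_set \<beta>" for s
    using that unfolding top digit_set_horner by (auto intro!: horner_mono simp: c_def)
qed

section \<open>Orbits\<close>

text \<open>Common to both maps: \<open>A i\<close> is the domain at time \<open>i\<close>, and each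
  step must subtract an admissible digit and land in the next domain.\<close>

lemma orbit_subtracts_digit:
  fixes F :: "nat \<times> real \<Rightarrow> nat \<times> real"
  assumes step: "\<And>i y. i < length \<beta> \<Longrightarrow> y \<in> A i \<Longrightarrow>
      \<exists>c\<in>{0..\<lceil>base \<beta> i\<rceil> - 1}. F (i, y) = ((i + 1) mod length \<beta>, base \<beta> i * y - of_int c)
        \<and> base \<beta> i * y - of_int c \<in> A (i + 1)"
    and x: "x \<in> A 0"
  obtains s where "s \<in> digit_set \<beta>"
    "snd ((F ^^ length \<beta>) (0, x)) = (\<Prod>i<length \<beta>. base \<beta> i) * x - s"
    "snd ((F ^^ length \<beta>) (0, x)) \<in> A (length \<beta>)"
proof -
  define y where "y n = snd ((F ^^ n) (0, x))" for n
  \<comment> \<open>The \<open>mod\<close> matters only at \<open>n = length \<beta>\<close>, where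
    the first coordinate returns to 0.\<close>
  have orbit: "(F ^^ n) (0, x) = (n mod length \<beta>, y n) \<and> y n \<in> A n" if "n \<le> length \<beta>" for n
    using that
  proof (induction n)
    case 0
    then show ?case using x by (simp add: y_def)
  next
    case (Suc n)
    then have n: "n < length \<beta>" and IH: "(F ^^ n) (0, x) = (n, y n)" "y n \<in> A n" by simp_all
    have "(F ^^ Suc n) (0, x) = F (n, y n)" using IH(1) by simp
    moreover have "y (Suc n) = snd (F (n, y n))" using calculation by (simp only: y_def)
    ultimately show ?case using step[OF n IH(2)] by auto
  qed
  have "\<exists>c\<in>{0..\<lceil>base \<beta> i\<rceil> - 1}. y (Suc i) = base \<beta> i * y i - of_int c" if "i < length \<beta>" for i
  proof -
    have "(F ^^ i) (0, x) = (i, y i)" "y i \<in> A i" using orbit[of i] that by simp_all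
    moreover from this(1) have "(F ^^ Suc i) (0, x) = F (i, y i)" by simp
    then have "y (Suc i) = snd (F (i, y i))" by (simp only: y_def)
    ultimately show ?thesis using step[OF that] by fastforce
  qed
  then obtain c where c: "\<And>i. i < length \<beta> \<Longrightarrow> c i \<in> {0..\<lceil>base \<beta> i\<rceil> - 1}"
      "\<And>i. i < length \<beta> \<Longrightarrow> y (Suc i) = base \<beta> i * y i - of_int (c i)"
    by metis
  show thesis
  proof
    show "horner \<beta> c (length \<beta>) \<in> digit_set \<beta>" using c(1) by (auto simp: digit_set_horner)
    show "snd ((F ^^ length \<beta>) (0, x)) = (\<Prod>i<length \<beta>. base \<beta> i) * x - horner \<beta> c (length \<beta>)"
      using horner_iterate[of _ y, OF c(2)] by (simp add: y_def)
    show "snd ((F ^^ length \<beta>) (0, x)) \<in> A (length \<beta>)"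
      using orbit[of "length \<beta>"] by (simp add: y_def)
  qed
qed

lemma greedy_map_step:
  assumes i: "i < length \<beta>" and y: "y \<in> {0..<x_sup (rotate i \<beta>)}"
  shows "\<exists>c\<in>{0..\<lceil>base \<beta> i\<rceil> - 1}.
      greedy_map \<beta> (i, y) = ((i + 1) mod length \<beta>, base \<beta> i * y - of_int c)
      \<and> base \<beta> i * y - of_int c \<in> {0..<x_sup (rotate (i + 1) \<beta>)}"
proof -
  have b: "base \<beta> i > 1" using base_gt_1 nonempty gt1 by blast
  show ?thesis
  proof (cases "y < 1")
    case True
    \<comment> \<open>Below 1 the digit is the floor; the remainder is less than 1, hence inside the
      next domain by \<open>x_sup_ge_1\<close>.\<close>
    have "base \<beta> i * y < base \<beta> i" using True b by simp
    then have "\<lfloor>base \<beta> i * y\<rfloor> \<le> \<lceil>base \<beta> i\<rceil> - 1" by linarith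
    moreover have "0 \<le> base \<beta> i * y" using b y by simp
    moreover have "base \<beta> i * y - of_int \<lfloor>base \<beta> i * y\<rfloor> < x_sup (rotate (i + 1) \<beta>)"
      using x_sup_ge_1[of "i + 1"] by linarith
    ultimately show ?thesis using True i y
      by (intro bexI[of _ "\<lfloor>base \<beta> i * y\<rfloor>"]) (auto simp: greedy_map_def)
  next
    case False
    \<comment> \<open>From 1 on the digit is maximal: the recursion carries the upper bound over,
      and \<open>y \<ge> 1\<close> keeps the result nonnegative.\<close>
    have "base \<beta> i * y < base \<beta> i * x_sup (rotate i \<beta>)" using y b by simp
    then have "base \<beta> i * y - of_int (\<lceil>base \<beta> i\<rceil> - 1) < x_sup (rotate (i + 1) \<beta>)"
      using x_sup_rec[of i] by simp
    moreover have "base \<beta> i * y \<ge> base \<beta> i" using b False by simp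
    then have "base \<beta> i * y - of_int (\<lceil>base \<beta> i\<rceil> - 1) \<ge> 0" by linarith
    moreover have "\<lceil>base \<beta> i\<rceil> - 1 \<ge> 0" using b by linarith
    ultimately show ?thesis using False i y
      by (intro bexI[of _ "\<lceil>base \<beta> i\<rceil> - 1"]) (auto simp: greedy_map_def)
  qed
qed

lemma lazy_map_step:
  assumes i: "i < length \<beta>" and y: "y \<in> {0<..x_sup (rotate i \<beta>)}"
  shows "\<exists>c\<in>{0..\<lceil>base \<beta> i\<rceil> - 1}.
      lazy_map \<beta> (i, y) = ((i + 1) mod length \<beta>, base \<beta> i * y - of_int c)
      \<and> base \<beta> i * y - of_int c \<in> {0<..x_sup (rotate (i + 1) \<beta>)}"
proof -
  have b: "base \<beta> i > 1" using base_gt_1 nonempty gt1 by blast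
  have pos: "base \<beta> i * y > 0" using y b by simp
  have rec: "base \<beta> i * (x_sup (rotate i \<beta>) - 1)
      = x_sup (rotate (i + 1) \<beta>) + of_int (\<lceil>base \<beta> i\<rceil> - 1) - base \<beta> i"
    using x_sup_rec[of i] by (simp add: algebra_simps)
  show ?thesis
  proof (cases "y \<le> x_sup (rotate i \<beta>) - 1")
    case True
    then have "base \<beta> i * y \<le> base \<beta> i * (x_sup (rotate i \<beta>) - 1)" using b by simp
    \<comment> \<open>The digit 0 suffices, because
      \<open>\<lceil>base \<beta> i\<rceil> - 1\<close> is less than
      \<open>base \<beta> i\<close>.\<close>
    then have "base \<beta> i * y \<le> x_sup (rotate (i + 1) \<beta>)" unfolding rec by linarith
    then show ?thesis using True i y pos b
      by (intro bexI[of _ 0]) (auto simp: lazy_map_def order_le_less)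
  next
    case False
    \<comment> \<open>The excess over the next supremum; its ceiling is the least integer whose
      subtraction gets below that supremum or onto it.\<close>
    define z where "z = base \<beta> i * y - x_sup (rotate (i + 1) \<beta>)"
    have "base \<beta> i * y \<le> base \<beta> i * x_sup (rotate i \<beta>)" using y b by simp
    then have "z \<le> of_int (\<lceil>base \<beta> i\<rceil> - 1)" using x_sup_rec[of i] by (simp add: z_def)
    then have "\<lceil>z\<rceil> \<le> \<lceil>base \<beta> i\<rceil> - 1" by (simp only: ceiling_le_iff)
    moreover have "base \<beta> i * y > base \<beta> i * (x_sup (rotate i \<beta>) - 1)" using False b by simp
    then have "z > -1" unfolding rec z_def by linarith
    then have "\<lceil>z\<rceil> \<ge> 0" by linarith
    \<comment> \<open>Rounding up overshoots by less than 1, so the result exceeds the next supremum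
      minus 1, which is nonnegative.\<close>
    moreover have "base \<beta> i * y - of_int \<lceil>z\<rceil> \<in> {0<..x_sup (rotate (i + 1) \<beta>)}"
      using x_sup_ge_1[of "i + 1"] ceiling_correct[of z]
      unfolding z_def greaterThanAtMost_iff by linarith
    ultimately show ?thesis using False i y
      by (intro bexI[of _ "\<lceil>z\<rceil>"]) (auto simp: lazy_map_def z_def)
  qed
qed

end

theorem proposition43:
  fixes p :: nat and \<beta> :: "real list"
  assumes "p \<ge> 1"
    and "length \<beta> = p"
    and "\<forall>i<p. \<beta> ! i > 1"
  shows "(\<forall>x\<in>{0..<x_sup \<beta>}.
            greedy_digit_map (\<Prod>i<p. \<beta> ! i) (digit_set \<beta>) x
              \<le> (snd \<circ> (greedy_map \<beta> ^^ p) \<circ> delta0) x) \<and>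
         (\<forall>x\<in>{0<..x_sup \<beta>}.
            lazy_digit_map (\<Prod>i<p. \<beta> ! i) (digit_set \<beta>) x
              \<ge> (snd \<circ> (lazy_map \<beta> ^^ p) \<circ> delta0) x)"
proof -
  have ne: "\<beta> \<noteq> []" and gt1: "\<forall>i<length \<beta>. \<beta> ! i > 1" using assms by auto
  have B: "(\<Prod>i<p. \<beta> ! i) = (\<Prod>i<length \<beta>. base \<beta> i)"
    using assms(2) by (simp add: base_def)
  note D = finite_digit_set prod_base_gt_1[OF ne gt1] Min_digit_set[OF ne gt1] Max_digit_set[OF ne gt1]
  show ?thesis
    unfolding B unfolding comp_def delta0_def assms(2)[symmetric]
  proof (intro conjI ballI)
    fix x assume x: "x \<in> {0..<x_sup \<beta>}"
    obtain s where "s \<in> digit_set \<beta>"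
      "snd ((greedy_map \<beta> ^^ length \<beta>) (0, x)) = (\<Prod>i<length \<beta>. base \<beta> i) * x - s"
      "snd ((greedy_map \<beta> ^^ length \<beta>) (0, x)) \<in> {0..<x_sup (rotate (length \<beta>) \<beta>)}"
      by (rule orbit_subtracts_digit[OF ne gt1, where A = "\<lambda>i. {0..<x_sup (rotate i \<beta>)}",
            OF greedy_map_step[OF ne gt1]]) (use x in auto)
    \<comment> \<open>Nonnegativity of the endpoint is the condition that
      \<open>greedy_digit_map_le\<close> puts on \<open>s\<close>.\<close>
    then show "greedy_digit_map (\<Prod>i<length \<beta>. base \<beta> i) (digit_set \<beta>) x
        \<le> snd ((greedy_map \<beta> ^^ length \<beta>) (0, x))"
      using greedy_digit_map_le[OF D, of x s] x by simp
  next
    fix x assume x: "x \<in> {0<..x_sup \<beta>}"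
    obtain s where "s \<in> digit_set \<beta>"
      "snd ((lazy_map \<beta> ^^ length \<beta>) (0, x)) = (\<Prod>i<length \<beta>. base \<beta> i) * x - s"
      "snd ((lazy_map \<beta> ^^ length \<beta>) (0, x)) \<in> {0<..x_sup (rotate (length \<beta>) \<beta>)}"
      by (rule orbit_subtracts_digit[OF ne gt1, where A = "\<lambda>i. {0<..x_sup (rotate i \<beta>)}",
            OF lazy_map_step[OF ne gt1]]) (use x in auto)
    \<comment> \<open>A full rotation is the identity, so the endpoint is at most
      \<open>x_sup \<beta>\<close>, as \<open>lazy_digit_map_ge\<close> requires of
      \<open>s\<close>.\<close>
    then show "snd ((lazy_map \<beta> ^^ length \<beta>) (0, x))
        \<le> lazy_digit_map (\<Prod>i<length \<beta>. base \<beta> i) (digit_set \<beta>) x"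
      using lazy_digit_map_ge[OF D, of x s] x by simp
  qed
qed

end
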